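(* Let $\mathcal L$ be a $5$-dimensional naturally graded $2$-filiform complex Leibniz algebra of type $\mu_{(I,1,2)}$. Then $\mathcal L$ is isomorphic to one of the following pairwise non-isomorphic algebras (each given on a basis $\{e_1,\dots,e_5\}$, all products of basis elements not listed being zero; $\mathbf i\in\mathbb C$ denotes the imaginary unit, $\mathbf i^2=-1$): $$\mu^1:\ [e_1,e_1]=e_2,\ [e_2,e_1]=e_3,\ [e_1,e_4]=e_2+e_5,\ [e_2,e_4]=e_3;$$ $$\mu^2:\ [e_1,e_1]=e_2,\ [e_2,e_1]=e_3,\ [e_1,e_4]=e_5;$$ $$\mu^3:\ [e_1,e_1]=e_2,\ [e_2,e_1]=e_3,\ [e_1,e_4]=\mathbf i\,e_2+e_5,\ [e_2,e_4]=\mathbf i\,e_3,\ [e_5,e_4]=e_3;$$ $$\mu^4:\ [e_1,e_1]=e_2,\ [e_2,e_1]=e_3,\ [e_1,e_4]=e_5,\ [e_5,e_4]=e_3.$$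
   Context: All algebras are finite-dimensional over $\mathbb C$. A Leibniz algebra is a vector space with a bilinear bracket satisfying $[x,[y,z]]=[[x,y],z]-[[x,z],y]$. Put $\mathcal L^1=\mathcal L$, $\mathcal L^{k+1}=[\mathcal L^k,\mathcal L]$; $\mathcal L$ is nilpotent if $\mathcal L^k=0$ for some $k$. For $x\in\mathcal L$ let $R_x(z)=[z,x]$. For nilpotent $\mathcal L$ and $x\in\mathcal L\setminus[\mathcal L,\mathcal L]$ let $C(x)$ be the decreasing sequence of sizes of the Jordan blocks of the nilpotent operator $R_x$; the characteristic sequence is $C(\mathcal L)=\max_{x\in\mathcal L\setminus[\mathcal L,\mathcal L]}C(x)$ in the lexicographic order. An $n$-dimensional nilpotent Leibniz algebra is $2$-filiform if $C(\mathcal L)=(n-2,1,1)$. Natural gradation: $\mathcal L_i=\mathcal L^i/\mathcal L^{i+1}$, $i\geq1$, with the induced bracket $[\mathcal L_i,\mathcal L_j]\subseteq\mathcal L_{i+j}$. $\mathcal L$ is naturally graded if $\mathcal L\cong\bigoplus_i\mathcal L_i$ as algebras; one then identifies $\mathcal L$ with $\bigoplus_i\mathcal L_i$. A naturally graded $n$-dimensional $2$-filiform algebra is of type $\mu_{(I,r_1,r_2)}$ (with $r_1\le r_2$) if it has a basis $\{e_1,\dots,e_n\}$ (adapted basis) of homogeneous elements with $e_1\in\mathcal L_1$, $C(e_1)=(n-2,1,1)$, $[e_i,e_1]=e_{i+1}$ for $1\le i\le n-3$, $[e_{n-2},e_1]=[e_{n-1},e_1]=[e_n,e_1]=0$ (so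 $e_i\in\mathcal L_i$ for $1\le i\le n-2$), and $e_{n-1}\in\mathcal L_{r_1}$, $e_n\in\mathcal L_{r_2}$. *)

theory Defs
  imports
    "HOL-Analysis.Cartesian_Space"
    "Jordan_Normal_Form.Jordan_Normal_Form"
begin

no_notation Matrix.vec_index (infixl "$" 100)
hide_const (open) Matrix.vec

locale leibniz_algebra = vector_space scale
  for scale :: "complex \<Rightarrow> 'a::ab_group_add \<Rightarrow> 'a" +
  fixes bracket :: "'a \<Rightarrow> 'a \<Rightarrow> 'a"
  assumes finite_dimensional: "\<exists>B. finite B \<and> span B = UNIV"
    and linear_left: "Vector_Spaces.linear scale scale (\<lambda>x. bracket x y)"
    and linear_right: "Vector_Spaces.linear scale scale (\<lambda>y. bracket x y)"
    and leibniz: "bracket x (bracket y z) = bracket (bracket x y) z - bracket (bracket x z) y"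
begin

text \<open>The series starts at index 1; the value at 0 is only a convention, which makes the
  quotient in degree 0 the zero space.\<close>

fun lcs :: "nat \<Rightarrow> 'a set" where
  "lcs 0 = UNIV"
| "lcs (Suc 0) = UNIV"
| "lcs (Suc (Suc k)) = span {bracket x y | x y. x \<in> lcs (Suc k)}"

definition nilpotent :: bool where
  "nilpotent \<longleftrightarrow> (\<exists>k\<ge>1. lcs k = {0})"

definition right_mult :: "'a \<Rightarrow> 'a \<Rightarrow> 'a" where
  "right_mult x z = bracket z x"

definition is_basis_list :: "'a list \<Rightarrow> bool" where
  "is_basis_list bs \<longleftrightarrow> distinct bs \<and> independent (set bs) \<and> span (set bs) = UNIV"

definition matrix_of :: "'a list \<Rightarrow> ('a \<Rightarrow> 'a) \<Rightarrow> complex mat" where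
  "matrix_of bs T = Matrix.mat (length bs) (length bs)
     (\<lambda>(i, j). representation (set bs) (T (bs ! j)) (bs ! i))"

text \<open>For a nilpotent operator, \<open>ns\<close> is the decreasing sequence of its Jordan block sizes;
  all blocks have eigenvalue 0, and \<^const>\<open>jordan_nf\<close> excludes blocks of size 0.\<close>

definition jordan_sizes :: "('a \<Rightarrow> 'a) \<Rightarrow> nat list \<Rightarrow> bool" where
  "jordan_sizes T ns \<longleftrightarrow> sorted_wrt (\<ge>) ns \<and>
     (\<exists>bs. is_basis_list bs \<and> jordan_nf (matrix_of bs T) (map (\<lambda>k. (k, 0)) ns))"

text \<open>\<open>ns\<close> is the maximum of the \<open>C(x)\<close>, \<open>x \<notin> [L, L]\<close>.\<close>

definition characteristic_sequence :: "nat list \<Rightarrow> bool" where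
  "characteristic_sequence ns \<longleftrightarrow>
     (\<exists>x. x \<notin> lcs 2 \<and> jordan_sizes (right_mult x) ns) \<and>
     (\<forall>x ms. x \<notin> lcs 2 \<and> jordan_sizes (right_mult x) ms \<longrightarrow> ord_class.lexordp_eq ms ns)"

definition two_filiform :: bool where
  "two_filiform \<longleftrightarrow> nilpotent \<and> characteristic_sequence [dim UNIV - 2, 1, 1]"

text \<open>The associated graded algebra: an element is a finitely supported family of cosets
  \<open>f i = x + L^(i+1)\<close> with \<open>x \<in> L^i\<close>; the zero of the \<open>i\<close>-th quotient is the coset \<open>L^(i+1)\<close>.
  The operations are the induced ones, written on all representatives at once.\<close>

definition gr_carrier :: "(nat \<Rightarrow> 'a set) set" where
  "gr_carrier = {f. (\<forall>i. \<exists>x\<in>lcs i. f i = {x + z | z. z \<in> lcs (Suc i)}) \<and>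
                    finite {i. f i \<noteq> lcs (Suc i)}}"

definition gr_add :: "(nat \<Rightarrow> 'a set) \<Rightarrow> (nat \<Rightarrow> 'a set) \<Rightarrow> nat \<Rightarrow> 'a set" where
  "gr_add f g i = {x + y | x y. x \<in> f i \<and> y \<in> g i}"

text \<open>The summand \<open>z\<close> is needed for \<open>c = 0\<close>.\<close>

definition gr_scale :: "complex \<Rightarrow> (nat \<Rightarrow> 'a set) \<Rightarrow> nat \<Rightarrow> 'a set" where
  "gr_scale c f i = {scale c x + z | x z. x \<in> f i \<and> z \<in> lcs (Suc i)}"

text \<open>The degree \<open>k\<close> part of the product is the sum of the products of the parts of degrees
  \<open>i\<close> and \<open>k - i\<close>; here \<open>u\<close> and \<open>v\<close> run over the families of representatives.\<close>

definition gr_bracket :: "(nat \<Rightarrow> 'a set) \<Rightarrow> (nat \<Rightarrow> 'a set) \<Rightarrow> nat \<Rightarrow> 'a set" where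
  "gr_bracket f g k =
     {(\<Sum>i\<in>{1..<k}. bracket (u i) (v (k - i))) + z | u v z.
        (\<forall>i. u i \<in> f i) \<and> (\<forall>i. v i \<in> g i) \<and> z \<in> lcs (Suc k)}"

definition gr_isomorphism :: "('a \<Rightarrow> nat \<Rightarrow> 'a set) \<Rightarrow> bool" where
  "gr_isomorphism \<phi> \<longleftrightarrow> bij_betw \<phi> UNIV gr_carrier \<and>
     (\<forall>x y. \<phi> (x + y) = gr_add (\<phi> x) (\<phi> y)) \<and>
     (\<forall>c x. \<phi> (scale c x) = gr_scale c (\<phi> x)) \<and>
     (\<forall>x y. \<phi> (bracket x y) = gr_bracket (\<phi> x) (\<phi> y))"

definition naturally_graded :: bool where
  "naturally_graded \<longleftrightarrow> (\<exists>\<phi>. gr_isomorphism \<phi>)"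

text \<open>The subspace \<open>L_i\<close> of the algebra, once identified with its associated graded algebra
  along \<open>\<phi>\<close>.\<close>

definition component :: "('a \<Rightarrow> nat \<Rightarrow> 'a set) \<Rightarrow> nat \<Rightarrow> 'a set" where
  "component \<phi> i = {x. \<forall>j. j \<noteq> i \<longrightarrow> \<phi> x j = lcs (Suc j)}"

text \<open>The basis is \<open>e 1, \<dots>, e n\<close> with \<open>n\<close> the dimension; other values of \<open>e\<close> are
  irrelevant.\<close>

definition adapted_basis_I ::
    "('a \<Rightarrow> nat \<Rightarrow> 'a set) \<Rightarrow> nat \<Rightarrow> nat \<Rightarrow> (nat \<Rightarrow> 'a) \<Rightarrow> bool" where
  "adapted_basis_I \<phi> r1 r2 e \<longleftrightarrow> (let n = dim UNIV in
     is_basis_list (map e [1..<n + 1]) \<and>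
     (\<forall>i\<in>{1..n}. \<exists>d\<ge>1. e i \<in> component \<phi> d) \<and>
     e 1 \<in> component \<phi> 1 \<and>
     jordan_sizes (right_mult (e 1)) [n - 2, 1, 1] \<and>
     (\<forall>i. 1 \<le> i \<and> i \<le> n - 3 \<longrightarrow> bracket (e i) (e 1) = e (i + 1)) \<and>
     bracket (e (n - 2)) (e 1) = 0 \<and>
     bracket (e (n - 1)) (e 1) = 0 \<and>
     bracket (e n) (e 1) = 0 \<and>
     e (n - 1) \<in> component \<phi> r1 \<and>
     e n \<in> component \<phi> r2)"

definition type_mu_I :: "nat \<Rightarrow> nat \<Rightarrow> bool" where
  "type_mu_I r1 r2 \<longleftrightarrow> r1 \<le> r2 \<and>
     (\<exists>\<phi>. gr_isomorphism \<phi> \<and> (\<exists>e. adapted_basis_I \<phi> r1 r2 e))"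

end

definition alg_isomorphic ::
    "(complex \<Rightarrow> 'a::ab_group_add \<Rightarrow> 'a) \<Rightarrow> ('a \<Rightarrow> 'a \<Rightarrow> 'a) \<Rightarrow>
     (complex \<Rightarrow> 'b::ab_group_add \<Rightarrow> 'b) \<Rightarrow> ('b \<Rightarrow> 'b \<Rightarrow> 'b) \<Rightarrow> bool" where
  "alg_isomorphic s1 b1 s2 b2 \<longleftrightarrow>
     (\<exists>f. Vector_Spaces.linear s1 s2 f \<and> bij f \<and> (\<forall>x y. f (b1 x y) = b2 (f x) (f y)))"

text \<open>The standard basis of \<open>complex ^ 5\<close>. In the index type \<^typ>\<open>5\<close>, the numerals 1 to 5 are
  the five distinct elements (with \<open>5 = 0\<close>).\<close>

abbreviation E :: "5 \<Rightarrow> complex ^ 5" where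
  "E i \<equiv> axis i 1"

text \<open>The bilinear product for which the product of the basis vectors \<open>E i\<close> and \<open>E j\<close> is \<open>v\<close>
  for every listed triple \<open>(i, j, v)\<close>, and zero for the pairs that are not listed.\<close>

definition table_bracket ::
    "(5 \<times> 5 \<times> (complex ^ 5)) list \<Rightarrow> complex ^ 5 \<Rightarrow> complex ^ 5 \<Rightarrow> complex ^ 5" where
  "table_bracket ps x y = (\<Sum>(i, j, v)\<leftarrow>ps. (x $ i * y $ j) *s v)"

definition mu1 :: "complex ^ 5 \<Rightarrow> complex ^ 5 \<Rightarrow> complex ^ 5" where
  "mu1 = table_bracket [(1, 1, E 2), (2, 1, E 3), (1, 4, E 2 + E 5), (2, 4, E 3)]"

definition mu2 :: "complex ^ 5 \<Rightarrow> complex ^ 5 \<Rightarrow> complex ^ 5" where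
  "mu2 = table_bracket [(1, 1, E 2), (2, 1, E 3), (1, 4, E 5)]"

definition mu3 :: "complex ^ 5 \<Rightarrow> complex ^ 5 \<Rightarrow> complex ^ 5" where
  "mu3 = table_bracket
     [(1, 1, E 2), (2, 1, E 3), (1, 4, \<i> *s E 2 + E 5), (2, 4, \<i> *s E 3), (5, 4, E 3)]"

definition mu4 :: "complex ^ 5 \<Rightarrow> complex ^ 5 \<Rightarrow> complex ^ 5" where
  "mu4 = table_bracket [(1, 1, E 2), (2, 1, E 3), (1, 4, E 5), (5, 4, E 3)]"

end

theory Submission
  imports Defs
begin

text \<open>In an adapted basis, the gradation and the Leibniz identity leave only
  \<open>[e1,e4] = a e2 + b e5\<close>, \<open>[e2,e4] = a e3\<close>, \<open>[e4,e4] = d e5\<close>, \<open>[e5,e4] = q e3\<close>, where \<open>(b, d)\<close> is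
  nonzero because the algebra is generated in degree 1. If \<open>d\<close> were nonzero, right multiplication
  by \<open>e4 + s e1\<close> would have Jordan blocks of sizes 3 and 2 for generic \<open>s\<close>, against 2-filiformity.
  So one can take \<open>b = 1\<close>.

  Up to the scalar factor \<open>x1\<close>, the \<open>e3\<close>-coordinate of \<open>[[x,y],z]\<close> for \<open>x, y, z\<close> of degree 1 is
  the symmetric bilinear form in \<open>(y, z)\<close> with Gram matrix \<open>((1, a), (a, a\<^sup>2 + q))\<close> in the basis \<open>e1, e4\<close>.
  The line of \<open>e4\<close> is canonical (left annihilators, modulo degrees 2 and 3), so the form has four
  types: it is degenerate (\<open>q = 0\<close>) or not, and this line is isotropic (\<open>a\<^sup>2 + q = 0\<close>) or not. These
  two properties separate the four algebras, and adapting \<open>e1\<close> and the scale of \<open>e4\<close> to the form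
  realises each normal form.\<close>

section \<open>Coordinates on \<open>complex ^ 5\<close> and the four products\<close>

lemma UNIV_5: "(UNIV :: 5 set) = {1, 2, 3, 4, 5}"
proof -
  have "card {1, 2, 3, 4, 5 :: 5} = CARD(5)" by simp
  then show ?thesis by (metis card_eq_UNIV_imp_eq_UNIV finite)
qed

lemma forall_5: "(\<forall>i :: 5. P i) \<longleftrightarrow> P 1 \<and> P 2 \<and> P 3 \<and> P 4 \<and> P 5"
proof -
  have "(\<forall>i :: 5. P i) \<longleftrightarrow> (\<forall>i \<in> {1, 2, 3, 4, 5}. P i)"
    unfolding UNIV_5[symmetric] by blast
  then show ?thesis by simp
qed

lemma mu_nth:
  "mu1 x y $ k = x$1*y$1*E 2$k + x$2*y$1*E 3$k + x$1*y$4*(E 2$k + E 5$k) + x$2*y$4*E 3$k"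
  "mu2 x y $ k = x$1*y$1*E 2$k + x$2*y$1*E 3$k + x$1*y$4*E 5$k"
  "mu3 x y $ k = x$1*y$1*E 2$k + x$2*y$1*E 3$k + x$1*y$4*(\<i>*E 2$k + E 5$k) + x$2*y$4*(\<i>*E 3$k)
     + x$5*y$4*E 3$k"
  "mu4 x y $ k = x$1*y$1*E 2$k + x$2*y$1*E 3$k + x$1*y$4*E 5$k + x$5*y$4*E 3$k"
  by (simp_all add: mu1_def mu2_def mu3_def mu4_def table_bracket_def)

section \<open>Invariants separating the four algebras\<close>

text \<open>With parameters \<open>a\<close>, \<open>q\<close> as above, a left annihilator y is y4
  e4 modulo degrees 2 and 3, and then [[x,y],y] is x1 y4^2 (a^2 + q) e3. The property thus expresses
  without a basis that the canonical line is isotropic.\<close>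

definition left_annihilators_square_zero :: "('a::zero \<Rightarrow> 'a \<Rightarrow> 'a) \<Rightarrow> bool" where
  "left_annihilators_square_zero b \<longleftrightarrow> (\<forall>y. (\<forall>x. b y x = 0) \<longrightarrow> (\<forall>x. b (b x y) y = 0))"

text \<open>Let B be the form with the Gram matrix above. Then [[x,y],z] is x1 B(y,z) e3, and [x,y]
  vanishes for all x exactly when y has no coordinates along e1 and e4. So this is the nondegeneracy
  of B, that is, \<open>q \<noteq> 0\<close>.\<close>

definition nondegenerate_double :: "('a::zero \<Rightarrow> 'a \<Rightarrow> 'a) \<Rightarrow> bool" where
  "nondegenerate_double b \<longleftrightarrow> (\<forall>y. (\<forall>x z. b (b x y) z = 0) \<longrightarrow> (\<forall>x. b x y = 0))"

lemma alg_isomorphic_invariants: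
  assumes "alg_isomorphic s1 b1 s2 b2"
  shows "left_annihilators_square_zero b1 \<longleftrightarrow> left_annihilators_square_zero b2"
    and "nondegenerate_double b1 \<longleftrightarrow> nondegenerate_double b2"
proof -
  obtain f where f: "Vector_Spaces.linear s1 s2 f" "bij f" and hom: "\<And>x y. f (b1 x y) = b2 (f x) (f y)"
    using assms unfolding alg_isomorphic_def by blast
  interpret f: Vector_Spaces.linear s1 s2 f by fact
  have zero: "b1 x y = 0 \<longleftrightarrow> b2 (f x) (f y) = 0" for x y
    by (metis f.zero f(2) bij_is_inj injD hom)
  \<comment> \<open>Surjectivity of \<open>f\<close> turns quantifiers over the second algebra into
    quantifiers over the first, after which the two sides of each claim coincide.\<close>
  have all: "(\<forall>y. P y) \<longleftrightarrow> (\<forall>x. P (f x))" for P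
    by (metis f(2) bij_is_surj surjD)
  show "left_annihilators_square_zero b1 \<longleftrightarrow> left_annihilators_square_zero b2"
    unfolding left_annihilators_square_zero_def all zero hom by (simp add: zero hom)
  show "nondegenerate_double b1 \<longleftrightarrow> nondegenerate_double b2"
    unfolding nondegenerate_double_def all zero hom by (simp add: zero hom)
qed

lemma left_annihilators_square_zero_mu:
  "\<not> left_annihilators_square_zero mu1" "left_annihilators_square_zero mu2"
  "left_annihilators_square_zero mu3" "\<not> left_annihilators_square_zero mu4"
proof -
  have "mu1 (E 4) x = 0" "mu1 (mu1 (E 1) (E 4)) (E 4) $ 3 = 1" for x
    by (simp_all add: Finite_Cartesian_Product.vec_eq_iff mu_nth axis_def)
  then show "\<not> left_annihilators_square_zero mu1"
    unfolding left_annihilators_square_zero_def by (metis zero_index zero_neq_one)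
  have "mu4 (E 4) x = 0" "mu4 (mu4 (E 1) (E 4)) (E 4) $ 3 = 1" for x
    by (simp_all add: Finite_Cartesian_Product.vec_eq_iff mu_nth axis_def)
  then show "\<not> left_annihilators_square_zero mu4"
    unfolding left_annihilators_square_zero_def by (metis zero_index zero_neq_one)
  show "left_annihilators_square_zero mu2"
    unfolding left_annihilators_square_zero_def
  proof (intro allI impI)
    fix x y :: "complex ^ 5" assume *: "\<forall>x. mu2 y x = 0"
    show "mu2 (mu2 x y) y = 0"
      using *[rule_format, of "E 1"]
      by (simp add: Finite_Cartesian_Product.vec_eq_iff forall_5 mu_nth axis_def)
  qed
  show "left_annihilators_square_zero mu3"
    unfolding left_annihilators_square_zero_def
  proof (intro allI impI)
    fix x y :: "complex ^ 5" assume *: "\<forall>x. mu3 y x = 0"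
    show "mu3 (mu3 x y) y = 0"
      using *[rule_format, of "E 1"]
      by (simp add: Finite_Cartesian_Product.vec_eq_iff forall_5 mu_nth axis_def algebra_simps)
  qed
qed

lemma nondegenerate_double_mu:
  "\<not> nondegenerate_double mu1" "\<not> nondegenerate_double mu2"
  "nondegenerate_double mu3" "nondegenerate_double mu4"
proof -
  \<comment> \<open>Degeneracy is shown by a vector spanning the kernel of the form: e4 - e1 for the
    Gram matrix ((1,1),(1,1)) of \<open>mu1\<close>, and e4 for the Gram matrix ((1,0),(0,0)) of
    \<open>mu2\<close>.\<close>
  have "mu1 (mu1 x (E 4 - E 1)) z = 0" "mu1 (E 1) (E 4 - E 1) $ 5 = 1" for x z
    by (simp_all add: Finite_Cartesian_Product.vec_eq_iff mu_nth axis_def)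
  then show "\<not> nondegenerate_double mu1"
    unfolding nondegenerate_double_def by (metis zero_index zero_neq_one)
  have "mu2 (mu2 x (E 4)) z = 0" "mu2 (E 1) (E 4) $ 5 = 1" for x z
    by (simp_all add: Finite_Cartesian_Product.vec_eq_iff mu_nth axis_def)
  then show "\<not> nondegenerate_double mu2"
    unfolding nondegenerate_double_def by (metis zero_index zero_neq_one)
  show "nondegenerate_double mu3"
    unfolding nondegenerate_double_def
  proof (intro allI impI)
    fix x y assume *: "\<forall>x z. mu3 (mu3 x y) z = 0"
    \<comment> \<open>Pairing y with e1 and with e4 gives the two rows of the Gram matrix
      ((1,\<i>),(\<i>,0)), whose last entry is \<i>^2 + 1 = 0.\<close>
    from *[rule_format, of "E 1" "E 1"] *[rule_format, of "E 1" "E 4"]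
    have "y $ 1 + y $ 4 * \<i> = 0" "y $ 1 * \<i> = 0"
      by (simp_all add: Finite_Cartesian_Product.vec_eq_iff forall_5 mu_nth axis_def algebra_simps)
    then show "mu3 x y = 0"
      by (simp add: Finite_Cartesian_Product.vec_eq_iff mu_nth)
  qed
  show "nondegenerate_double mu4"
    unfolding nondegenerate_double_def
  proof (intro allI impI)
    fix x y assume *: "\<forall>x z. mu4 (mu4 x y) z = 0"
    from *[rule_format, of "E 1" "E 1"] *[rule_format, of "E 1" "E 4"]
    have "y $ 1 = 0" "y $ 4 = 0"
      by (simp_all add: Finite_Cartesian_Product.vec_eq_iff forall_5 mu_nth axis_def algebra_simps)
    then show "mu4 x y = 0"
      by (simp add: Finite_Cartesian_Product.vec_eq_iff mu_nth)
  qed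
qed

text \<open>The two invariants take four different pairs of truth values on the four
  algebras.\<close>

lemma mu_pairwise_not_isomorphic:
  "\<not> alg_isomorphic (*s) mu1 (*s) mu2" "\<not> alg_isomorphic (*s) mu1 (*s) mu3"
  "\<not> alg_isomorphic (*s) mu1 (*s) mu4" "\<not> alg_isomorphic (*s) mu2 (*s) mu3"
  "\<not> alg_isomorphic (*s) mu2 (*s) mu4" "\<not> alg_isomorphic (*s) mu3 (*s) mu4"
  using left_annihilators_square_zero_mu nondegenerate_double_mu
  by (auto dest: alg_isomorphic_invariants)

section \<open>The associated graded algebra\<close>

context leibniz_algebra
begin

lemma bracket_left_hom [simp]:
  "bracket (x + x') y = bracket x y + bracket x' y"
  "bracket (x - x') y = bracket x y - bracket x' y"
  "bracket (scale c x) y = scale c (bracket x y)"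
  "bracket 0 y = 0"
proof -
  interpret l: Vector_Spaces.linear scale scale "\<lambda>x. bracket x y" by (rule linear_left)
  show "bracket (x + x') y = bracket x y + bracket x' y"
    "bracket (x - x') y = bracket x y - bracket x' y"
    "bracket (scale c x) y = scale c (bracket x y)" "bracket 0 y = 0"
    by (rule l.add l.diff l.scale l.zero)+
qed

lemma bracket_right_hom [simp]:
  "bracket x (y + y') = bracket x y + bracket x y'"
  "bracket x (y - y') = bracket x y - bracket x y'"
  "bracket x (scale c y) = scale c (bracket x y)"
  "bracket x 0 = 0"
proof -
  interpret l: Vector_Spaces.linear scale scale "\<lambda>y. bracket x y" by (rule linear_right)
  show "bracket x (y + y') = bracket x y + bracket x y'"
    "bracket x (y - y') = bracket x y - bracket x y'"
    "bracket x (scale c y) = scale c (bracket x y)" "bracket x 0 = 0"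
    by (rule l.add l.diff l.scale l.zero)+
qed

lemma bracket_in_subspace:
  assumes "subspace S" "x \<in> span X" "y \<in> span Y" "\<And>a b. a \<in> X \<Longrightarrow> b \<in> Y \<Longrightarrow> bracket a b \<in> S"
  shows "bracket x y \<in> S"
proof -
  have *: "bracket a y \<in> S" if "a \<in> X" for a
    using \<open>y \<in> span Y\<close>
    by (rule span_induct)
      (auto simp: subspace_def assms(4) that subspace_0[OF assms(1)] subspace_add[OF assms(1)]
        subspace_scale[OF assms(1)])
  show ?thesis
    using \<open>x \<in> span X\<close>
    by (rule span_induct)
      (auto simp: subspace_def * subspace_0[OF assms(1)] subspace_add[OF assms(1)]
        subspace_scale[OF assms(1)])
qed

lemma subspace_lcs: "subspace (lcs k)"
  by (cases k rule: lcs.cases) auto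

lemma lcs_closed [simp, intro]:
  "0 \<in> lcs k" "x \<in> lcs k \<Longrightarrow> y \<in> lcs k \<Longrightarrow> x + y \<in> lcs k"
  "x \<in> lcs k \<Longrightarrow> y \<in> lcs k \<Longrightarrow> x - y \<in> lcs k" "x \<in> lcs k \<Longrightarrow> scale c x \<in> lcs k"
  using subspace_lcs by (auto intro: subspace_0 subspace_add subspace_diff subspace_scale)

section \<open>Homogeneous components along an isomorphism with the associated graded
  algebra\<close>

context
  fixes \<phi>
  assumes iso: "gr_isomorphism \<phi>"
begin

lemma gr_iso_add: "\<phi> (x + y) k = {u + v | u v. u \<in> \<phi> x k \<and> v \<in> \<phi> y k}"
  using iso by (simp add: gr_isomorphism_def gr_add_def)

lemma gr_iso_scale: "\<phi> (scale c x) k = {scale c u + z | u z. u \<in> \<phi> x k \<and> z \<in> lcs (Suc k)}"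
  using iso by (simp add: gr_isomorphism_def gr_scale_def)

lemma gr_iso_carrier: "\<phi> x \<in> gr_carrier"
  using iso by (auto simp: gr_isomorphism_def bij_betw_def)

lemma gr_iso_nonempty: "\<exists>w \<in> lcs k. w \<in> \<phi> x k"
proof -
  obtain w where "w \<in> lcs k" "\<phi> x k = {w + z | z. z \<in> lcs (Suc k)}"
    using gr_iso_carrier[of x] unfolding gr_carrier_def by blast
  then show ?thesis by (intro bexI[of _ w]) (auto intro: exI[of _ 0])
qed

lemma coset_iff: "y \<in> {w + z | z. z \<in> lcs k} \<longleftrightarrow> y - w \<in> lcs k"
  by (auto simp: algebra_simps intro!: exI[of _ "y - w"])

lemma gr_iso_coset:
  assumes "w \<in> \<phi> x k"
  shows "\<phi> x k = {w + z | z. z \<in> lcs (Suc k)}"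
proof -
  obtain w' where w': "\<phi> x k = {w' + z | z. z \<in> lcs (Suc k)}"
    using gr_iso_carrier[of x] unfolding gr_carrier_def by blast
  then have w: "w - w' \<in> lcs (Suc k)" using assms unfolding w' coset_iff by blast
  have "y - w' \<in> lcs (Suc k) \<longleftrightarrow> y - w \<in> lcs (Suc k)" for y
    using lcs_closed(2)[OF _ w, of "y - w"] lcs_closed(3)[OF _ w, of "y - w'"] by auto
  then show ?thesis unfolding w' set_eq_iff coset_iff by blast
qed

text \<open>Vanishing of the degree \<open>k\<close> part is tested from here on by membership of 0,
  a condition that passes easily to sums and multiples.\<close>

lemma gr_iso_eq_lcs_iff: "\<phi> x k = lcs (Suc k) \<longleftrightarrow> 0 \<in> \<phi> x k"
  using gr_iso_coset[of 0 x k] by auto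

lemma gr_iso_0: "\<phi> 0 k = lcs (Suc k)"
  using gr_iso_scale[of 0 0 k] gr_iso_nonempty[of k 0] by auto

lemma gr_iso_inj: "(\<And>k. \<phi> x k = \<phi> y k) \<Longrightarrow> x = y"
  using iso by (metis ext gr_isomorphism_def bij_betw_imp_inj_on injD)

lemma subspace_gr_iso_zero: "subspace {y. 0 \<in> \<phi> y k}"
proof -
  have "0 \<in> \<phi> (x + y) k" if "0 \<in> \<phi> x k" "0 \<in> \<phi> y k" for x y
    unfolding gr_iso_add using that by force
  moreover have "0 \<in> \<phi> (scale c x) k" if "0 \<in> \<phi> x k" for c x
    unfolding gr_iso_scale using that by (intro CollectI exI[of _ 0]) simp
  ultimately show ?thesis by (simp add: subspace_def gr_iso_0)
qed

lemma component_iff: "x \<in> component \<phi> i \<longleftrightarrow> (\<forall>j. j \<noteq> i \<longrightarrow> 0 \<in> \<phi> x j)"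
  by (simp add: component_def gr_iso_eq_lcs_iff)

lemma subspace_component: "subspace (component \<phi> i)"
  using subspace_gr_iso_zero by (simp add: subspace_def component_iff)

text \<open>Any choice of representatives computes the product. Taking 0 outside degree
  \<open>i\<close> for \<open>x\<close> and outside degree \<open>j\<close> for \<open>y\<close>
  leaves no nonzero term in a degree other than \<open>i + j\<close>.\<close>

lemma component_bracket:
  assumes x: "x \<in> component \<phi> i" and y: "y \<in> component \<phi> j"
  shows "bracket x y \<in> component \<phi> (i + j)"
proof -
  have "0 \<in> \<phi> (bracket x y) k" if k: "k \<noteq> i + j" for k
  proof -
    define u where "u l = (if l = i then SOME w. w \<in> \<phi> x l else 0)" for l
    define v where "v l = (if l = j then SOME w. w \<in> \<phi> y l else 0)" for l
    have u: "u l \<in> \<phi> x l" for l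
      using x gr_iso_nonempty[of l x] unfolding u_def component_iff by (auto intro: someI)
    have v: "v l \<in> \<phi> y l" for l
      using y gr_iso_nonempty[of l y] unfolding v_def component_iff by (auto intro: someI)
    have "(\<Sum>l\<in>{1..<k}. bracket (u l) (v (k - l))) = 0"
      using k by (intro sum.neutral) (auto simp: u_def v_def)
    moreover have "\<phi> (bracket x y) k = {(\<Sum>i\<in>{1..<k}. bracket (u i) (v (k - i))) + z | u v z.
        (\<forall>i. u i \<in> \<phi> x i) \<and> (\<forall>i. v i \<in> \<phi> y i) \<and> z \<in> lcs (Suc k)}"
      using iso by (simp add: gr_isomorphism_def gr_bracket_def)
    ultimately show ?thesis using u v
      by - (erule ssubst, rule CollectI, rule exI[of _ u], rule exI[of _ v], rule exI[of _ 0], simp)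
  qed
  then show ?thesis by (simp add: component_iff)
qed

lemma gr_iso_sum_components:
  assumes "finite I" "\<And>i. i \<in> I \<Longrightarrow> x i \<in> component \<phi> i" "w \<in> \<phi> (\<Sum>i\<in>I. x i) k" "k \<in> I"
  shows "w \<in> \<phi> (x k) k"
proof -
  have "(\<Sum>i\<in>I - {k}. x i) \<in> {y. 0 \<in> \<phi> y k}"
  proof (rule subspace_sum)
    show "subspace {y. 0 \<in> \<phi> y k}" by (rule subspace_gr_iso_zero)
    show "x i \<in> {y. 0 \<in> \<phi> y k}" if "i \<in> I - {k}" for i
      using assms(2)[of i] that by (auto simp: component_iff)
  qed
  then have "\<phi> (\<Sum>i\<in>I - {k}. x i) k = lcs (Suc k)" by (simp add: gr_iso_eq_lcs_iff)
  moreover have "(\<Sum>i\<in>I. x i) = x k + (\<Sum>i\<in>I - {k}. x i)"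
    using assms by (simp add: sum.remove)
  ultimately obtain a z where "w = a + z" "a \<in> \<phi> (x k) k" "z \<in> lcs (Suc k)"
    using assms(3) by (auto simp: gr_iso_add)
  then show ?thesis using gr_iso_coset[of a "x k" k] by auto
qed

text \<open>This is the directness of the sum of the components: the degree \<open>k\<close> part of
  the sum is that of \<open>x k\<close>, the other parts of \<open>x k\<close> vanish anyway, and
  \<open>\<phi>\<close> is injective.\<close>

lemma component_independent:
  assumes "finite I" "\<And>i. i \<in> I \<Longrightarrow> x i \<in> component \<phi> i" "(\<Sum>i\<in>I. x i) = 0" "k \<in> I"
  shows "x k = 0"
proof (rule gr_iso_inj)
  fix j
  have "0 \<in> \<phi> (x k) j"
  proof (cases "j = k")
    case True
    then show ?thesis using gr_iso_sum_components[OF assms(1,2), of 0 k] assms by (simp add: gr_iso_0)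
  qed (use assms(2)[OF assms(4)] in \<open>auto simp: component_iff\<close>)
  then show "\<phi> (x k) j = \<phi> 0 j" by (simp add: gr_iso_0 gr_iso_eq_lcs_iff)
qed

lemma component_eq_of_sum:
  assumes "finite I" "\<And>i. i \<in> I \<Longrightarrow> p i \<in> component \<phi> i" "(\<Sum>i\<in>I. p i) \<in> component \<phi> d"
  shows "(\<Sum>i\<in>I. p i) = (if d \<in> I then p d else 0)"
proof -
  define y where "y = (\<Sum>i\<in>I. p i)"
  \<comment> \<open>The total \<open>y\<close> is subtracted at index \<open>d\<close>, so the
    family over \<open>insert d I\<close> sums to 0 and directness applies. If \<open>d\<close> lies
    outside \<open>I\<close>, this forces \<open>y = 0\<close>.\<close>
  define x where "x i = (if i \<in> I then p i else 0) - (if i = d then y else 0)" for i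
  have "x d = 0"
  proof (rule component_independent)
    show "finite (insert d I)" using assms by simp
    show "x i \<in> component \<phi> i" if "i \<in> insert d I" for i
      using assms that unfolding x_def y_def
      by (auto intro!: subspace_diff subspace_component subspace_0 subspace_neg)
    have "(\<Sum>i\<in>insert d I. if i \<in> I then p i else 0) = y"
      unfolding y_def using assms(1) by (intro sum.mono_neutral_cong_right) auto
    then show "(\<Sum>i\<in>insert d I. x i) = 0"
      using assms(1) by (simp add: x_def sum_subtractf)
  qed simp
  then show ?thesis by (auto simp: x_def y_def)
qed

text \<open>Every element represents a class of degree 1, since \<open>lcs 1\<close> is the whole
  space; the family concentrated in degree 1 at this class has a preimage because
  \<open>\<phi>\<close> is onto.\<close>

lemma component_1_lift: "\<exists>X \<in> component \<phi> 1. x \<in> \<phi> X 1"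
proof -
  define f where "f i = (if i = 1 then {x + z | z. z \<in> lcs (Suc i)} else lcs (Suc i))" for i :: nat
  have "finite {i. f i \<noteq> lcs (Suc i)}"
    by (rule finite_subset[of _ "{1}"]) (auto simp: f_def)
  moreover have "\<exists>x\<in>lcs i. f i = {x + z | z. z \<in> lcs (Suc i)}" for i
  proof (cases "i = 1")
    case True
    then show ?thesis by (intro bexI[of _ x]) (simp_all add: f_def)
  next
    case False
    then show ?thesis by (intro bexI[of _ 0]) (simp_all add: f_def del: lcs.simps)
  qed
  ultimately have "f \<in> gr_carrier" by (simp add: gr_carrier_def)
  then obtain X where X: "\<phi> X = f"
    using iso unfolding gr_isomorphism_def bij_betw_def by (metis imageE)
  have "X \<in> component \<phi> 1" by (simp add: component_def X f_def)
  moreover have "x \<in> \<phi> X 1" by (auto simp: X f_def intro: exI[of _ 0] simp del: lcs.simps)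
  ultimately show ?thesis by blast
qed

text \<open>The associated graded algebra is generated in degree 1, so its degree 2 part consists of
  products, and \<open>\<phi>\<close> carries this back to the algebra itself.\<close>

lemma component_2_subset_lcs: "component \<phi> 2 \<subseteq> lcs 2"
proof
  fix y assume y: "y \<in> component \<phi> 2"
  \<comment> \<open>The set of degree 2 classes represented by an element that is both homogeneous
    and in \<open>lcs 2\<close>. It is a subspace containing all products, since the factors can be
    lifted to degree 1, so it contains \<open>lcs 2\<close>.\<close>
  let ?S = "{w. \<exists>W \<in> component \<phi> 2 \<inter> lcs 2. w \<in> \<phi> W 2}"
  have sub: "subspace (component \<phi> 2 \<inter> lcs 2)"
    by (intro subspace_inter subspace_component subspace_lcs)
  have lift: "\<exists>W \<in> component \<phi> 2 \<inter> lcs 2. w \<in> \<phi> W 2" if "w \<in> lcs (Suc (Suc 0))" for w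
    using that[unfolded lcs.simps(3)]
  proof (rule span_induct)
    show "subspace ?S"
      unfolding subspace_def
    proof (intro conjI ballI allI)
      show "0 \<in> ?S" using subspace_0[OF sub] by (auto intro!: bexI[of _ 0] simp: gr_iso_0)
    next
      fix a b assume "a \<in> ?S" "b \<in> ?S"
      then obtain A B where "A \<in> component \<phi> 2 \<inter> lcs 2" "a \<in> \<phi> A 2"
        "B \<in> component \<phi> 2 \<inter> lcs 2" "b \<in> \<phi> B 2" by auto
      then show "a + b \<in> ?S" using subspace_add[OF sub]
        by (intro CollectI bexI[of _ "A + B"]) (auto simp: gr_iso_add)
    next
      fix c a assume "a \<in> ?S"
      then obtain A where "A \<in> component \<phi> 2 \<inter> lcs 2" "a \<in> \<phi> A 2" by auto
      then show "scale c a \<in> ?S" using subspace_scale[OF sub]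
        by (intro CollectI bexI[of _ "scale c A"])
          (unfold gr_iso_scale, rule CollectI, rule exI[of _ a], rule exI[of _ 0], simp_all)
    qed
  next
    fix w assume "w \<in> {bracket x y | x y. x \<in> lcs (Suc 0)}"
    then obtain a b where w: "w = bracket a b" by auto
    obtain A B where A: "A \<in> component \<phi> 1" "a \<in> \<phi> A 1" and B: "B \<in> component \<phi> 1" "b \<in> \<phi> B 1"
      using component_1_lift by meson
    have "bracket A B \<in> component \<phi> 2" using component_bracket[OF A(1) B(1)] by (simp add: numeral_2_eq_2)
    moreover have "bracket A B \<in> lcs 2" by (auto simp: numeral_2_eq_2 intro: span_base)
    moreover have "w \<in> \<phi> (bracket A B) 2"
    proof -
      define u where "u l = (if l = 1 then a else 0)" for l :: nat
      define v where "v l = (if l = 1 then b else 0)" for l :: nat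
      have "\<forall>l. u l \<in> \<phi> A l" "\<forall>l. v l \<in> \<phi> B l"
        using A B by (auto simp: u_def v_def component_iff)
      moreover have "\<phi> (bracket A B) 2 = {(\<Sum>i\<in>{1..<2}. bracket (u i) (v (2 - i))) + z | u v z.
          (\<forall>i. u i \<in> \<phi> A i) \<and> (\<forall>i. v i \<in> \<phi> B i) \<and> z \<in> lcs (Suc 2)}"
        using iso by (simp add: gr_isomorphism_def gr_bracket_def)
      moreover have "bracket a b = (\<Sum>i\<in>{1..<2}. bracket (u i) (v (2 - i))) + 0"
        by (simp add: u_def v_def numeral_2_eq_2)
      ultimately show ?thesis unfolding w
        by - (erule ssubst[of "\<phi> (bracket A B) 2"], rule CollectI, rule exI[of _ u],
            rule exI[of _ v], rule exI[of _ 0], simp)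
    qed
    ultimately show "\<exists>W \<in> component \<phi> 2 \<inter> lcs 2. w \<in> \<phi> W 2" by blast
  qed
  obtain w where "w \<in> lcs 2" and w: "w \<in> \<phi> y 2" using gr_iso_nonempty by blast
  then obtain W where W: "W \<in> component \<phi> 2" "W \<in> lcs 2" "w \<in> \<phi> W 2"
    using lift[of w] by (auto simp: numeral_2_eq_2)
  \<comment> \<open>Both are homogeneous of degree 2 and share the representative \<open>w\<close>
    there, so injectivity of \<open>\<phi>\<close> identifies them.\<close>
  have "y = W"
  proof (rule gr_iso_inj)
    fix k show "\<phi> y k = \<phi> W k"
      using y W gr_iso_coset[OF w] gr_iso_coset[OF W(3)] by (cases "k = 2") (simp_all add: component_def)
  qed
  then show "y \<in> lcs 2" using W by simp
qed

end

section \<open>Normal forms\<close>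

definition combination :: "'a \<Rightarrow> 'a \<Rightarrow> 'a \<Rightarrow> 'a \<Rightarrow> 'a \<Rightarrow> complex ^ 5 \<Rightarrow> 'a" where
  "combination b1 b2 b3 b4 b5 v =
     scale (v $ 1) b1 + scale (v $ 2) b2 + scale (v $ 3) b3 + scale (v $ 4) b4 + scale (v $ 5) b5"

lemma linear_combination:
  "Vector_Spaces.linear (*s) scale (combination b1 b2 b3 b4 b5)"
  unfolding Vector_Spaces.linear_iff
  by (simp add: combination_def vec.vector_space_axioms vector_space_axioms scale_left_distrib
      scale_right_distrib algebra_simps)

lemma span_5:
  assumes "x \<in> span {b1, b2, b3, b4, b5}"
  obtains c1 c2 c3 c4 c5
  where "x = scale c1 b1 + scale c2 b2 + scale c3 b3 + scale c4 b4 + scale c5 b5"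
proof -
  from assms obtain c1 c2 c3 c4 c5
    where "x - scale c1 b1 - scale c2 b2 - scale c3 b3 - scale c4 b4 - scale c5 b5 = 0"
    unfolding span_insert span_empty by auto
  then have "x = scale c1 b1 + scale c2 b2 + scale c3 b3 + scale c4 b4 + scale c5 b5"
    by (simp add: algebra_simps)
  then show ?thesis by (rule that)
qed

lemma finite_basis_exists:
  obtains B where "finite_dimensional_vector_space scale B"
proof -
  obtain B where B: "independent B" "span B = UNIV"
    using maximal_independent_subset[of UNIV] by (metis top.extremum_uniqueI)
  obtain F where F: "finite F" "span F = UNIV" using finite_dimensional by blast
  have "finite B" using independent_span_bound[OF F(1) B(1)] F(2) by auto
  then have "finite_dimensional_vector_space scale B" using B by unfold_locales auto
  then show thesis by (rule that)
qed

context
  assumes dim_5: "dim UNIV = 5"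
begin

text \<open>A surjective linear map between spaces of equal finite dimension is injective; hence
  only spanning has to be checked for each of the bases below.\<close>

lemma bij_combination:
  assumes "span {b1, b2, b3, b4, b5} = UNIV"
  shows "bij (combination b1 b2 b3 b4 b5)"
proof -
  obtain B where "finite_dimensional_vector_space scale B" by (rule finite_basis_exists)
  then interpret fd: finite_dimensional_vector_space scale B .
  interpret pair: finite_dimensional_vector_space_pair "(*s) :: complex \<Rightarrow> complex ^ 5 \<Rightarrow> _"
    cart_basis scale B ..
  have surj: "surj (combination b1 b2 b3 b4 b5)"
  proof (rule surjI)
    fix x
    have "\<exists>v. combination b1 b2 b3 b4 b5 v = x"
    proof -
      obtain c1 c2 c3 c4 c5
        where "x = scale c1 b1 + scale c2 b2 + scale c3 b3 + scale c4 b4 + scale c5 b5"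
        using assms span_5[of x] by blast
      then have "combination b1 b2 b3 b4 b5
        (\<chi> i. if i = 1 then c1 else if i = 2 then c2 else if i = 3 then c3 else if i = 4 then c4 else c5) = x"
        by (simp add: combination_def)
      then show ?thesis by blast
    qed
    then show "combination b1 b2 b3 b4 b5 (SOME v. combination b1 b2 b3 b4 b5 v = x) = x"
      by (rule someI_ex)
  qed
  moreover have "inj (combination b1 b2 b3 b4 b5)"
    by (rule pair.linear_surjective_imp_injective[OF linear_combination surj])
      (simp only: dim_5 vec_dim_card, simp)
  ultimately show ?thesis by (simp add: bij_def)
qed

lemma coefficients_zero:
  assumes "span {b1, b2, b3, b4, b5} = UNIV"
    and "scale c1 b1 + scale c2 b2 + scale c3 b3 + scale c4 b4 + scale c5 b5 = 0"
  shows "c1 = 0" "c2 = 0" "c3 = 0" "c4 = 0" "c5 = 0"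
proof -
  define v :: "complex ^ 5" where "v = (\<chi> i. if i = 1 then c1 else if i = 2 then c2
    else if i = 3 then c3 else if i = 4 then c4 else c5)"
  have "combination b1 b2 b3 b4 b5 v = combination b1 b2 b3 b4 b5 0"
    using assms(2) by (simp add: combination_def v_def)
  then have "v = 0"
    using bij_combination[OF assms(1)] by (metis bij_is_inj injD)
  then have "v $ i = 0" for i by simp
  from this[of 1] this[of 2] this[of 3] this[of 4] this[of 5]
  show "c1 = 0" "c2 = 0" "c3 = 0" "c4 = 0" "c5 = 0" by (simp_all add: v_def)
qed

lemma is_basis_list_5:
  assumes "span {b1, b2, b3, b4, b5} = UNIV"
  shows "is_basis_list [b1, b2, b3, b4, b5]"
proof -
  let ?bs = "[b1, b2, b3, b4, b5]"
  obtain B where "finite_dimensional_vector_space scale B" by (rule finite_basis_exists)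
  then interpret fd: finite_dimensional_vector_space scale B .
  have span: "span (set ?bs) = UNIV" using assms by simp
  have "5 \<le> card (set ?bs)" using dim_le_card[of UNIV "set ?bs"] span dim_5 by simp
  moreover have "card (set ?bs) \<le> 5" using card_length[of ?bs] by simp
  ultimately have card: "card (set ?bs) = 5" by simp
  have "distinct ?bs" using card by (intro card_distinct) simp
  moreover have "independent (set ?bs)"
    by (rule fd.card_le_dim_spanning[of _ UNIV]) (use span card dim_5 in auto)
  ultimately show ?thesis using span by (simp add: is_basis_list_def)
qed

text \<open>Columns of \<open>matrix_of\<close> are images of basis vectors and Jordan blocks carry
  their ones above the diagonal, so each chain is listed starting from its kernel vector.\<close>

lemma jordan_sizes_3_2:
  assumes span: "span {b1, b2, b3, b4, b5} = UNIV"
    and T: "T b1 = 0" "T b2 = b1" "T b3 = b2" "T b4 = 0" "T b5 = b4"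
  shows "jordan_sizes T [3, 2]"
proof -
  let ?bs = "[b1, b2, b3, b4, b5]"
  have bs: "is_basis_list ?bs" using span by (rule is_basis_list_5)
  then have ind: "independent (set ?bs)" and dist: "distinct ?bs"
    by (auto simp: is_basis_list_def)
  have rep: "representation {b1, b2, b3, b4, b5} b = (\<lambda>v. if v = b then 1 else 0)"
    if "b \<in> {b1, b2, b3, b4, b5}" for b
    using representation_basis[OF ind, of b] that by simp
  have "matrix_of ?bs T = jordan_matrix [(3, 0), (2, 0)]"
  proof (rule eq_matI)
    fix i j assume "i < dim_row (jordan_matrix [(3, 0), (2, 0 :: complex)])"
      "j < dim_col (jordan_matrix [(3, 0), (2, 0 :: complex)])"
    then have "i \<in> {0, 1, 2, 3, 4}" "j \<in> {0, 1, 2, 3, 4}" by auto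
    then show "matrix_of ?bs T $$ (i, j) = jordan_matrix [(3, 0), (2, 0)] $$ (i, j)"
      using dist
      by (auto simp: matrix_of_def jordan_matrix_def T rep representation_zero Let_def)
  qed (simp_all add: matrix_of_def)
  moreover have "similar_mat (jordan_matrix [(3, 0), (2, 0 :: complex)]) (jordan_matrix [(3, 0), (2, 0)])"
    by (rule similar_mat_refl[of _ 5]) auto
  ultimately show ?thesis
    using bs unfolding jordan_sizes_def jordan_nf_def by auto
qed

end

section \<open>The normal form with two parameters and its changes of basis\<close>

definition normal_basis :: "complex \<Rightarrow> complex \<Rightarrow> 'a \<Rightarrow> 'a \<Rightarrow> 'a \<Rightarrow> 'a \<Rightarrow> 'a \<Rightarrow> bool" where
  "normal_basis a q f1 f2 f3 f4 f5 \<longleftrightarrow> span {f1, f2, f3, f4, f5} = UNIV \<and>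
     bracket f1 f1 = f2 \<and> bracket f2 f1 = f3 \<and> bracket f3 f1 = 0 \<and> bracket f4 f1 = 0 \<and>
     bracket f5 f1 = 0 \<and>
     bracket f1 f4 = scale a f2 + f5 \<and> bracket f2 f4 = scale a f3 \<and> bracket f3 f4 = 0 \<and>
     bracket f4 f4 = 0 \<and> bracket f5 f4 = scale q f3 \<and>
     (\<forall>x. bracket x f2 = 0 \<and> bracket x f3 = 0 \<and> bracket x f5 = 0)"

definition has_normal_basis :: "complex \<Rightarrow> complex \<Rightarrow> bool" where
  "has_normal_basis a q \<longleftrightarrow> (\<exists>f1 f2 f3 f4 f5. normal_basis a q f1 f2 f3 f4 f5)"

text \<open>The formula for \<open>m\<close> is the multiplication table of a normal basis in
  coordinates, so \<open>combination\<close> is an isomorphism from the table algebra, and its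
  inverse is the map sought.\<close>

lemma has_normal_basis_alg_isomorphic:
  assumes "dim UNIV = 5" and "has_normal_basis a q"
    and m: "\<And>x y. m x y = (x $ 1 * y $ 1 + a * (x $ 1 * y $ 4)) *s E 2
      + (x $ 2 * y $ 1 + a * (x $ 2 * y $ 4) + q * (x $ 5 * y $ 4)) *s E 3 + (x $ 1 * y $ 4) *s E 5"
  shows "alg_isomorphic scale bracket (*s) m"
proof -
  obtain f1 f2 f3 f4 f5 where nb: "normal_basis a q f1 f2 f3 f4 f5"
    using assms(2) unfolding has_normal_basis_def by blast
  let ?h = "combination f1 f2 f3 f4 f5"
  have bij: "bij ?h" using nb by (intro bij_combination assms(1)) (simp add: normal_basis_def)
  have hom: "?h (m x y) = bracket (?h x) (?h y)" for x y
    using nb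
    by (simp add: normal_basis_def combination_def m axis_def scale_left_distrib
        scale_right_distrib algebra_simps)
  interpret h: Vector_Spaces.linear "(*s)" scale ?h by (rule linear_combination)
  have inv: "inv_into UNIV ?h x = v \<longleftrightarrow> x = ?h v" for x v
    using bij by (metis bij_inv_eq_iff)
  have hinv: "?h (inv_into UNIV ?h x) = x" for x
    using bij by (simp add: bij_is_surj surj_f_inv_f)
  have "Vector_Spaces.linear scale (*s) (inv_into UNIV ?h)"
    unfolding Vector_Spaces.linear_iff
    by (auto simp: vec.vector_space_axioms vector_space_axioms inv h.add h.scale hinv)
  moreover have "bij (inv_into UNIV ?h)" using bij by (rule bij_imp_bij_inv)
  moreover have "inv_into UNIV ?h (bracket x y) = m (inv_into UNIV ?h x) (inv_into UNIV ?h y)" for x y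
    by (simp add: inv hom hinv)
  ultimately show ?thesis unfolding alg_isomorphic_def by blast
qed

lemma span_eq_UNIV_mono:
  assumes "span S = UNIV" "S \<subseteq> span T"
  shows "span T = UNIV"
  using assms by (metis span_mono span_span top.extremum_uniqueI)

text \<open>The new generators are f1 + t f4 and c f4. In terms of the form, \<open>D\<close> is the
  value at the first one, the right side of \<open>a'\<close> is its pairing with the second, and
  the determinant \<open>q\<close> is multiplied by c^2. Replacing f3 by D f3 divides the form by
  \<open>D\<close>, and the determinant by D^2.\<close>

lemma has_normal_basis_change:
  assumes "has_normal_basis a q" and "c \<noteq> 0"
    and D: "D = 1 + 2 * a * t + (a\<^sup>2 + q) * t\<^sup>2" "D \<noteq> 0"
    and a': "a' * D = c * (a + (a\<^sup>2 + q) * t)"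
    and q': "q' * D\<^sup>2 = c\<^sup>2 * q"
  shows "has_normal_basis a' q'"
proof -
  obtain f1 f2 f3 f4 f5 where nb: "normal_basis a q f1 f2 f3 f4 f5"
    using assms(1) unfolding has_normal_basis_def by blast
  define g1 where "g1 = f1 + scale t f4"
  define g4 where "g4 = scale c f4"
  \<comment> \<open>The remaining vectors are dictated by the table: g2 = [g1,g1], g3 = [g2,g1] and
    g5 = [g1,g4] - a' g2.\<close>
  define g2 where "g2 = scale (1 + a * t) f2 + scale t f5"
  define g3 where "g3 = scale D f3"
  define g5 where "g5 = scale (c * a - a' * (1 + a * t)) f2 + scale (c - a' * t) f5"
  let ?S = "{g1, g2, g3, g4, g5}"
  have nb': "bracket f1 f1 = f2" "bracket f2 f1 = f3" "bracket f3 f1 = 0" "bracket f4 f1 = 0"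
     "bracket f5 f1 = 0" "bracket f1 f4 = scale a f2 + f5" "bracket f2 f4 = scale a f3"
     "bracket f3 f4 = 0" "bracket f4 f4 = 0" "bracket f5 f4 = scale q f3"
     "bracket x f2 = 0" "bracket x f3 = 0" "bracket x f5 = 0" for x
    using nb by (auto simp: normal_basis_def)
  have f2_g1: "bracket f2 g1 = scale (1 + t * a) f3" and f5_g1: "bracket f5 g1 = scale (t * q) f3"
    by (simp_all add: g1_def nb' scale_left_distrib)
  have base: "g1 \<in> span ?S" "g2 \<in> span ?S" "g3 \<in> span ?S" "g4 \<in> span ?S" "g5 \<in> span ?S"
    by (auto intro: span_base)
  have f4: "f4 \<in> span ?S"
    using span_scale[OF base(4), of "1 / c"] \<open>c \<noteq> 0\<close> by (simp add: g4_def)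
  have f1: "f1 \<in> span ?S"
    using span_diff[OF base(1) span_scale[OF f4, of t]] by (simp add: g1_def)
  have f3: "f3 \<in> span ?S"
    using span_scale[OF base(3), of "1 / D"] D(2) by (simp add: g3_def)
  \<comment> \<open>The left side is [g1,g4] = c [f1,f4], and g2 = f2 + t [f1,f4]; so f2 and then f5
    are recovered by way of [f1,f4].\<close>
  have "scale a' g2 + g5 = scale c (scale a f2 + f5)"
    by (simp add: g2_def g5_def scale_right_distrib algebra_simps flip: scale_left_distrib)
  then have *: "scale a f2 + f5 \<in> span ?S"
    using span_scale[OF span_add[OF span_scale[OF base(2), of a'] base(5)], of "1 / c"] \<open>c \<noteq> 0\<close>
    by simp
  have "f2 = g2 - scale t (scale a f2 + f5)"
    by (simp add: g2_def scale_left_distrib scale_right_distrib algebra_simps)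
  then have f2: "f2 \<in> span ?S"
    using span_diff[OF base(2) span_scale[OF *, of t]] by simp
  have f5: "f5 \<in> span ?S"
    using span_diff[OF * span_scale[OF f2, of a]] by simp
  have "span {f1, f2, f3, f4, f5} = UNIV" using nb by (simp add: normal_basis_def)
  then have "span ?S = UNIV"
    by (rule span_eq_UNIV_mono) (use f1 f2 f3 f4 f5 in auto)
  moreover have "bracket g1 g1 = g2"
    by (simp add: g1_def g2_def nb' scale_left_distrib scale_right_distrib algebra_simps)
  moreover have "bracket g2 g1 = g3"
  proof -
    have "bracket g2 g1 = scale ((1 + a * t) * (1 + t * a) + t * (t * q)) f3"
      by (simp only: g2_def bracket_left_hom f2_g1 f5_g1 scale_scale flip: scale_left_distrib)
    then show ?thesis unfolding g3_def D by (simp add: algebra_simps power2_eq_square)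
  qed
  moreover have "bracket g3 g1 = 0" "bracket g4 g1 = 0" "bracket g3 g4 = 0" "bracket g4 g4 = 0"
    by (simp_all add: g1_def g3_def g4_def nb')
  moreover have "bracket g5 g1 = 0"
  proof -
    have "bracket g5 g1 = scale ((c * a - a' * (1 + a * t)) * (1 + t * a) + (c - a' * t) * (t * q)) f3"
      by (simp only: g5_def bracket_left_hom f2_g1 f5_g1 scale_scale flip: scale_left_distrib)
    also have "(c * a - a' * (1 + a * t)) * (1 + t * a) + (c - a' * t) * (t * q)
        = c * (a + (a\<^sup>2 + q) * t) - a' * D"
      unfolding D by (simp add: algebra_simps power2_eq_square)
    also have "\<dots> = 0" using a' by simp
    finally show ?thesis by simp
  qed
  moreover have "bracket g1 g4 = scale a' g2 + g5"
    by (simp add: g1_def g2_def g4_def g5_def nb' scale_left_distrib scale_right_distrib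
        scale_left_diff_distrib algebra_simps)
  moreover have "bracket g2 g4 = scale a' g3"
  proof -
    have "bracket g2 g4 = scale (c * (a + (a\<^sup>2 + q) * t)) f3"
      by (simp add: g2_def g4_def nb' scale_left_distrib scale_right_distrib
          algebra_simps power2_eq_square)
    then show ?thesis using a' by (simp add: g3_def)
  qed
  moreover have "bracket g5 g4 = scale q' g3"
  proof -
    have "bracket g5 g4 = scale (c * (c * (a\<^sup>2 + q) - a' * (a + (a\<^sup>2 + q) * t))) f3"
      by (simp add: g5_def g4_def nb' scale_left_distrib scale_right_distrib
          scale_left_diff_distrib algebra_simps power2_eq_square)
    moreover have "c * (c * (a\<^sup>2 + q) - a' * (a + (a\<^sup>2 + q) * t)) = q' * D"
    proof -
      \<comment> \<open>Multiplying by the nonzero \<open>D\<close> allows \<open>a' * D\<close> to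
        be replaced; what remains is the determinant identity (a^2 + q) D - (a + (a^2 + q) t)^2 =
        q.\<close>
      have "(c * (c * (a\<^sup>2 + q) - a' * (a + (a\<^sup>2 + q) * t))) * D
        = c * (c * (a\<^sup>2 + q) * D - (a' * D) * (a + (a\<^sup>2 + q) * t))"
        by (simp add: algebra_simps)
      also have "\<dots> = c * (c * (a\<^sup>2 + q) * D - c * (a + (a\<^sup>2 + q) * t) * (a + (a\<^sup>2 + q) * t))"
        by (simp only: a')
      also have "\<dots> = c\<^sup>2 * q"
        unfolding D by (simp add: algebra_simps power2_eq_square)
      also have "\<dots> = (q' * D) * D"
        unfolding q'[symmetric] by (simp only: power2_eq_square mult.assoc)
      finally show ?thesis using D(2) by simp
    qed
    ultimately show ?thesis by (simp add: g3_def)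
  qed
  moreover have "bracket x g2 = 0" "bracket x g3 = 0" "bracket x g5 = 0" for x
    by (simp_all add: g2_def g3_def g5_def nb')
  ultimately have "normal_basis a' q' g1 g2 g3 g4 g5" by (simp add: normal_basis_def)
  then show ?thesis unfolding has_normal_basis_def by blast
qed

lemma has_normal_basis_cases:
  assumes "has_normal_basis a q"
  shows "has_normal_basis 1 0 \<or> has_normal_basis 0 0 \<or> has_normal_basis \<i> 1 \<or> has_normal_basis 0 1"
proof -
  note change = has_normal_basis_change[OF assms _ refl]
  consider "q = 0" "a = 0" | "q = 0" "a \<noteq> 0" | "q \<noteq> 0" "a\<^sup>2 + q = 0" | "q \<noteq> 0" "a\<^sup>2 + q \<noteq> 0"
    by blast
  then show ?thesis
  proof cases
    case 1
    then show ?thesis using assms by auto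
  next
    case 2
    then show ?thesis using change[of "1 / a" 0 1 0] by auto
  next
    case 3
    then have "a \<noteq> 0" "q = - a\<^sup>2" by (auto simp: add_eq_0_iff)
    \<comment> \<open>With t = 0 only f4 is rescaled, giving a' = c a and q' = c^2 q. The target q'
      = 1 with a'^2 + q' = 0 is where the imaginary unit comes from.\<close>
    then show ?thesis using change[of "\<i> / a" 0 \<i> 1] by (auto simp: power_divide)
  next
    case 4
    \<comment> \<open>The shift t = -a/s makes f1 + t f4 orthogonal to f4, so a' = 0 and D = q/s;
      the square root of q in the scale then normalises q' to 1.\<close>
    define s where "s = a\<^sup>2 + q"
    have "s \<noteq> 0" using 4 by (simp add: s_def)
    have D: "1 + 2 * a * (- a / s) + (a\<^sup>2 + q) * (- a / s)\<^sup>2 = q / s"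
    proof -
      have "1 + 2 * a * (- a / s) + s * (- a / s)\<^sup>2 = (s - a\<^sup>2) / s"
        using \<open>s \<noteq> 0\<close> by (simp add: field_simps power2_eq_square)
      then show ?thesis by (simp add: s_def)
    qed
    have "csqrt q / s \<noteq> 0" using \<open>s \<noteq> 0\<close> 4 by simp
    moreover have "1 + 2 * a * (- a / s) + (a\<^sup>2 + q) * (- a / s)\<^sup>2 \<noteq> 0"
      unfolding D using 4 \<open>s \<noteq> 0\<close> by simp
    moreover have "0 * (1 + 2 * a * (- a / s) + (a\<^sup>2 + q) * (- a / s)\<^sup>2)
        = csqrt q / s * (a + (a\<^sup>2 + q) * (- a / s))"
      using \<open>s \<noteq> 0\<close> by (simp flip: s_def)
    moreover have "1 * (1 + 2 * a * (- a / s) + (a\<^sup>2 + q) * (- a / s)\<^sup>2)\<^sup>2 = (csqrt q / s)\<^sup>2 * q"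
      unfolding D by (simp add: power_divide) (simp add: power2_eq_square)
    ultimately show ?thesis using change[of "csqrt q / s" "- a / s" 0 1] by auto
  qed
qed

section \<open>Reduction to a normal form\<close>

lemma lcs_2_subset:
  assumes "span X = UNIV" "\<And>x y. x \<in> X \<Longrightarrow> y \<in> X \<Longrightarrow> bracket x y \<in> span S"
  shows "lcs 2 \<subseteq> span S"
proof -
  have "bracket x y \<in> span S" for x y
    by (rule bracket_in_subspace[OF subspace_span]) (use assms in auto)
  then show ?thesis
    unfolding numeral_2_eq_2 lcs.simps(3) by (intro span_minimal subspace_span) auto
qed

text \<open>e1 and e4 have degree 1, e2 and e5 degree 2, e3 degree 3, and nothing lies above; this
  confines every product. The coefficients \<open>c1\<close> and \<open>c4\<close> stay open here:
  they vanish once \<open>b \<noteq> 0\<close> is known.\<close>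

lemma adapted_basis_I_1_2_brackets:
  assumes dim_5: "dim UNIV = 5" and iso: "gr_isomorphism \<phi>" and "adapted_basis_I \<phi> 1 2 e"
  obtains e1 e2 e3 e4 e5 a b d q c1 c4
  where "span {e1, e2, e3, e4, e5} = UNIV"
    and "bracket e1 e1 = e2" "bracket e2 e1 = e3" "bracket e3 e1 = 0" "bracket e4 e1 = 0"
      "bracket e5 e1 = 0"
    and "bracket e1 e4 = scale a e2 + scale b e5" "bracket e2 e4 = scale a e3"
      "bracket e3 e4 = 0" "bracket e4 e4 = scale d e5" "bracket e5 e4 = scale q e3"
    and "bracket e1 e5 = scale c1 e3" "bracket e2 e5 = 0" "bracket e3 e5 = 0"
      "bracket e4 e5 = scale c4 e3" "bracket e5 e5 = 0"
    and "\<And>x. bracket x e2 = 0" "\<And>x. bracket x e3 = 0"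
    and "e5 \<in> lcs 2"
proof -
  define e1 e2 e3 e4 e5 where "e1 = e 1" "e2 = e 2" "e3 = e 3" "e4 = e 4" "e5 = e 5"
  note e_defs = this
  have upt: "[1..<5 + 1] = [1, 2, 3, 4, 5 :: nat]" by (simp add: upt_rec)
  have "is_basis_list (map e [1..<5 + 1])"
    and ad: "e 1 \<in> component \<phi> 1" "\<forall>i. 1 \<le> i \<and> i \<le> 5 - 3 \<longrightarrow> bracket (e i) (e 1) = e (i + 1)"
      "bracket (e (5 - 2)) (e 1) = 0" "bracket (e (5 - 1)) (e 1) = 0" "bracket (e 5) (e 1) = 0"
      "e (5 - 1) \<in> component \<phi> 1" "e 5 \<in> component \<phi> 2"
    using assms(3) unfolding adapted_basis_I_def Let_def dim_5 by blast+
  then have span: "span {e1, e2, e3, e4, e5} = UNIV"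
    unfolding upt by (simp add: is_basis_list_def e_defs)
  have R1: "bracket e1 e1 = e2" "bracket e2 e1 = e3" "bracket e3 e1 = 0" "bracket e4 e1 = 0"
      "bracket e5 e1 = 0"
    using ad(2)[rule_format, of 1] ad(2)[rule_format, of 2] ad(3-5)
    by (simp_all add: e_defs numeral_eq_Suc)
  have comp: "e1 \<in> component \<phi> 1" "e4 \<in> component \<phi> 1" "e5 \<in> component \<phi> 2"
    using ad(1,6,7) by (simp_all add: e_defs)
  note mult = component_bracket[OF iso]
  have comp2: "e2 \<in> component \<phi> 2"
    using mult[OF comp(1) comp(1)] by (simp add: R1 numeral_eq_Suc)
  have comp3: "e3 \<in> component \<phi> 3"
    using mult[OF comp2 comp(1)] by (simp add: R1 numeral_eq_Suc)
  note zero = coefficients_zero[OF dim_5 span]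
  \<comment> \<open>Grouping the expansion of \<open>y\<close> by degree gives the pieces
    \<open>p 1\<close>, \<open>p 2\<close>, \<open>p 3\<close>; a homogeneous \<open>y\<close>
    equals the piece of its own degree, or 0 if there is none.\<close>
  have coord: "\<exists>p. (\<forall>i. p i \<in> component \<phi> i) \<and> y = (if d \<in> {1, 2, 3} then p d else 0) \<and>
      (\<exists>c1 c2 c3 c4 c5. p 1 = scale c1 e1 + scale c4 e4 \<and> p 2 = scale c2 e2 + scale c5 e5 \<and> p 3 = scale c3 e3)"
    if "y \<in> component \<phi> d" for y d
  proof -
    obtain c1 c2 c3 c4 c5
      where y: "y = scale c1 e1 + scale c2 e2 + scale c3 e3 + scale c4 e4 + scale c5 e5"
      using span span_5[of y] by blast
    define p where "p i = (if i = 1 then scale c1 e1 + scale c4 e4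
      else if i = 2 then scale c2 e2 + scale c5 e5 else if i = 3 then scale c3 e3 else 0)" for i :: nat
    have p: "p i \<in> component \<phi> i" for i
      using comp comp2 comp3 subspace_component[OF iso]
      by (auto simp: p_def intro: subspace_add subspace_scale subspace_0)
    have y_sum: "y = (\<Sum>i\<in>{1, 2, 3}. p i)"
      by (simp add: p_def y algebra_simps)
    have "(\<Sum>i\<in>{1, 2, 3}. p i) = (if d \<in> {1, 2, 3} then p d else 0)"
      using that p unfolding y_sum by (intro component_eq_of_sum[OF iso]) auto
    then have "y = (if d \<in> {1, 2, 3} then p d else 0)" using y_sum by simp
    then show ?thesis using p by (intro exI[of _ p]) (auto simp: p_def)
  qed
  have coord2: "\<exists>c2 c5. y = scale c2 e2 + scale c5 e5" if "y \<in> component \<phi> (1 + 1)" for y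
    using coord[of y 2] that by (auto simp: numeral_2_eq_2)
  have coord3: "\<exists>c3. y = scale c3 e3" if "y \<in> component \<phi> d" "d = 3" for y d
    using coord[of y d] that by auto
  have coord4: "y = 0" if "y \<in> component \<phi> k" "k > 3" for y k
    using coord[of y k] that by auto
  obtain a b where ab: "bracket e1 e4 = scale a e2 + scale b e5"
    using coord2[OF mult[OF comp(1,2)]] by blast
  obtain c d where cd: "bracket e4 e4 = scale c e2 + scale d e5"
    using coord2[OF mult[OF comp(2,2)]] by blast
  obtain p where p: "bracket e2 e4 = scale p e3"
    using coord3[OF mult[OF comp2 comp(2)]] by auto
  obtain q where q: "bracket e5 e4 = scale q e3"
    using coord3[OF mult[OF comp(3,2)]] by auto
  obtain c1 where c1: "bracket e1 e5 = scale c1 e3"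
    using coord3[OF mult[OF comp(1,3)]] by auto
  obtain c4 where c4: "bracket e4 e5 = scale c4 e3"
    using coord3[OF mult[OF comp(2,3)]] by auto
  have zeros: "bracket e3 e4 = 0" "bracket e2 e5 = 0" "bracket e3 e5 = 0" "bracket e5 e5 = 0"
    using coord4[OF mult[OF comp3 comp(2)]] coord4[OF mult[OF comp2 comp(3)]]
      coord4[OF mult[OF comp3 comp(3)]] coord4[OF mult[OF comp(3,3)]] by simp_all
  \<comment> \<open>The right side of the Leibniz identity vanishes for equal second and third
    arguments, so the square e2 = [e1,e1] annihilates from the right; e3 = [e2,e1] inherits
    this.\<close>
  have R2: "bracket x e2 = 0" for x
    using leibniz[of x e1 e1] by (simp add: R1)
  have R3: "bracket x e3 = 0" for x
    using leibniz[of x e2 e1] by (simp add: R1 R2)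
  have e3: "s = 0" if "scale s e3 = 0" for s
    using zero(3)[of 0 0 s 0 0] that by simp
  \<comment> \<open>Since [e4,e1] = 0, the Leibniz identity equates [[e1,e4],e1] = a e3 with
    [[e1,e1],e4] = p e3; with e4 in place of the first e1 it kills the e2-coefficient of
    [e4,e4].\<close>
  have "scale (a - p) e3 = 0"
    using leibniz[of e1 e4 e1] by (simp add: R1 ab p scale_left_diff_distrib)
  then have "p = a" using e3[of "a - p"] by simp
  have "scale c e3 = 0"
    using leibniz[of e4 e4 e1] by (simp add: R1 cd)
  then have "c = 0" by (rule e3)
  have "e5 \<in> lcs 2" using component_2_subset_lcs[OF iso] comp(3) by blast
  show thesis
    by (rule that[of e1 e2 e3 e4 e5 a b d q c1 c4])
      (use span R1 ab cd p q c1 c4 zeros R2 R3 \<open>p = a\<close> \<open>c = 0\<close> \<open>e5 \<in> lcs 2\<close> in simp_all)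
qed

lemma has_normal_basis_exists:
  assumes dim_5: "dim UNIV = 5" and "two_filiform" "type_mu_I 1 2"
  shows "\<exists>a q. has_normal_basis a q"
proof -
  obtain \<phi> e where "gr_isomorphism \<phi>" "adapted_basis_I \<phi> 1 2 e"
    using assms(3) unfolding type_mu_I_def by blast
  then obtain e1 e2 e3 e4 e5 a b d q c1 c4
    where span: "span {e1, e2, e3, e4, e5} = UNIV"
    and R1: "bracket e1 e1 = e2" "bracket e2 e1 = e3" "bracket e3 e1 = 0" "bracket e4 e1 = 0"
      "bracket e5 e1 = 0"
    and R4: "bracket e1 e4 = scale a e2 + scale b e5" "bracket e2 e4 = scale a e3"
      "bracket e3 e4 = 0" "bracket e4 e4 = scale d e5" "bracket e5 e4 = scale q e3"
    and R5: "bracket e1 e5 = scale c1 e3" "bracket e2 e5 = 0" "bracket e3 e5 = 0"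
      "bracket e4 e5 = scale c4 e3" "bracket e5 e5 = 0"
    and R23: "\<And>x. bracket x e2 = 0" "\<And>x. bracket x e3 = 0"
    and e5: "e5 \<in> lcs 2"
    by (rule adapted_basis_I_1_2_brackets[OF dim_5]) blast
  note zero = coefficients_zero[OF dim_5 span]
  have lcs: "lcs 2 \<subseteq> span {e2, e3, e5}"
    by (rule lcs_2_subset[OF span])
      (auto simp: R1 R4 R5 R23 intro!: span_add span_scale span_zero intro: span_base)
  have "d = 0"
  proof (rule ccontr)
    assume "d \<noteq> 0"
    \<comment> \<open>Here t = s + a for the generic s of the overview. The number t^2 + b q is the
      e3-coefficient of the square of right multiplication by \<open>x\<close> at e1, and t = 1
      works unless b q = -1.\<close>
    obtain t where t: "t \<noteq> 0" "t\<^sup>2 + b * q \<noteq> 0"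
    proof (cases "1 + b * q = 0")
      case True
      then have "b * q = - 1" by (simp add: add_eq_0_iff)
      then show thesis using that[of 2] by simp
    qed (use that[of 1] in simp)
    define m where "m = t\<^sup>2 + b * q"
    define r where "r = d * q / m"
    define x where "x = scale (t - a) e1 + e4"
    let ?T = "right_mult x"
    have T: "?T e1 = scale t e2 + scale b e5" "?T e2 = scale t e3" "?T e3 = 0"
      "?T e4 = scale d e5" "?T e5 = scale q e3"
      by (simp_all add: right_mult_def x_def R1 R4 scale_left_diff_distrib)
    have T_lin: "?T (y + z) = ?T y + ?T z" "?T (y - z) = ?T y - ?T z" "?T (scale c y) = scale c (?T y)"
      for y z c by (simp_all add: right_mult_def)
    \<comment> \<open>The chain e1, w2, w1 has length 3. Subtracting r e1 from e4, with r m = d q,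
      makes the second image vanish, so w5, w4 is a chain of length 2.\<close>
    define w1 where "w1 = scale m e3"
    define w2 where "w2 = scale t e2 + scale b e5"
    define w4 where "w4 = scale d e5 - scale r w2"
    define w5 where "w5 = e4 - scale r e1"
    have Tw2: "?T w2 = w1"
      by (simp add: w2_def w1_def T_lin T m_def power2_eq_square flip: scale_left_distrib)
    have "m \<noteq> 0" using t by (simp add: m_def)
    have "?T w4 = scale (d * q - r * m) e3"
      by (simp add: w4_def T_lin Tw2 T w1_def scale_left_diff_distrib)
    then have Tw4: "?T w4 = 0" using \<open>m \<noteq> 0\<close> by (simp add: r_def)
    have Tw: "?T w1 = 0" "?T e1 = w2" "?T w5 = w4"
      by (simp_all add: T T_lin w1_def w2_def w4_def w5_def)
    let ?S = "{w1, w2, e1, w4, w5}"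
    have base: "w1 \<in> span ?S" "w2 \<in> span ?S" "e1 \<in> span ?S" "w4 \<in> span ?S" "w5 \<in> span ?S"
      by (auto intro: span_base)
    have "e3 \<in> span ?S"
      using span_scale[OF base(1), of "1 / m"] \<open>m \<noteq> 0\<close> by (simp add: w1_def)
    moreover have "e4 \<in> span ?S"
      using span_add[OF base(5) span_scale[OF base(3), of r]] by (simp add: w5_def)
    moreover have "scale d e5 \<in> span ?S"
      using span_add[OF base(4) span_scale[OF base(2), of r]] by (simp add: w4_def)
    then have "e5 \<in> span ?S"
      using span_scale[of "scale d e5" ?S "1 / d"] \<open>d \<noteq> 0\<close> by simp
    moreover have "scale t e2 \<in> span ?S"
      using span_diff[OF base(2) span_scale[OF \<open>e5 \<in> span ?S\<close>, of b]] by (simp add: w2_def)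
    then have "e2 \<in> span ?S"
      using span_scale[of "scale t e2" ?S "1 / t"] t(1) by simp
    ultimately have "span ?S = UNIV"
      using base by (intro span_eq_UNIV_mono[OF span]) auto
    then have "jordan_sizes ?T [3, 2]"
      by (rule jordan_sizes_3_2[OF dim_5]) fact+
    moreover have "x \<notin> lcs 2"
    proof
      assume "x \<in> lcs 2"
      then have "x \<in> span {e2, e3, e5}" using lcs by blast
      then obtain u2 u3 u5 where "x - scale u2 e2 - scale u3 e3 - scale u5 e5 = 0"
        unfolding span_insert span_empty by auto
      then have "scale (t - a) e1 + scale (- u2) e2 + scale (- u3) e3 + scale 1 e4 + scale (- u5) e5 = 0"
        by (simp add: x_def algebra_simps)
      from zero(4)[OF this] show False by simp
    qed
    \<comment> \<open>(3,2) exceeds (3,1,1) lexicographically, against the maximality in the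
      characteristic sequence.\<close>
    ultimately have "ord_class.lexordp_eq [3, 2] [dim UNIV - 2, 1, 1]"
      using assms(2) unfolding two_filiform_def characteristic_sequence_def by blast
    then show False by (simp add: dim_5)
  qed
  \<comment> \<open>If b and d both vanished, all products would lie in the span of e2 and e3, yet
    e5 lies in \<open>lcs 2\<close>.\<close>
  have "b \<noteq> 0"
  proof
    assume "b = 0"
    have "lcs 2 \<subseteq> span {e2, e3}"
      by (rule lcs_2_subset[OF span])
        (auto simp: R1 R4 R5 R23 \<open>b = 0\<close> \<open>d = 0\<close> intro!: span_add span_scale span_zero intro: span_base)
    then obtain u2 u3 where "e5 - scale u2 e2 - scale u3 e3 = 0"
      using e5 unfolding span_insert span_empty by auto
    then have "scale 0 e1 + scale (- u2) e2 + scale (- u3) e3 + scale 0 e4 + scale 1 e5 = 0"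
      by (simp add: algebra_simps)
    from zero(5)[OF this] show False by simp
  qed
  have be5: "scale b e5 = bracket e1 e4 - scale a e2" by (simp add: R4)
  \<comment> \<open>By the Leibniz identity [x,[y,z]] is antisymmetric in y and z, so [x,[e1,e4]] =
    -[x,[e4,e1]] = 0.\<close>
  have "bracket x (scale b e5) = 0" for x
    using leibniz[of x e1 e4] leibniz[of x e4 e1] unfolding be5 by (simp add: R1 R23)
  moreover have "span {e1, e2, e3, e4, scale b e5} = UNIV"
  proof (rule span_eq_UNIV_mono[OF span])
    have "scale (1 / b) (scale b e5) \<in> span {e1, e2, e3, e4, scale b e5}"
      by (intro span_scale span_base) simp
    then show "{e1, e2, e3, e4, e5} \<subseteq> span {e1, e2, e3, e4, scale b e5}"
      using \<open>b \<noteq> 0\<close> by (auto intro: span_base)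
  qed
  \<comment> \<open>Taking b e5 as the fifth vector normalises \<open>b\<close> to 1 and turns
    \<open>q\<close> into \<open>b * q\<close>.\<close>
  ultimately have "normal_basis a (b * q) e1 e2 e3 e4 (scale b e5)"
    using R1 R4 R23 \<open>d = 0\<close> by (auto simp: normal_basis_def)
  then show ?thesis unfolding has_normal_basis_def by blast
qed

text \<open>The parameter pairs (1,0), (0,0), (\<i>,1), (0,1) give the tables of \<open>mu1\<close>,
  \<open>mu2\<close>, \<open>mu3\<close>, \<open>mu4\<close> in this order.\<close>

lemma mu_classification:
  assumes "dim UNIV = 5" "two_filiform" "type_mu_I 1 2"
  shows "alg_isomorphic scale bracket (*s) mu1 \<or> alg_isomorphic scale bracket (*s) mu2 \<or>
    alg_isomorphic scale bracket (*s) mu3 \<or> alg_isomorphic scale bracket (*s) mu4"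
proof -
  note iso = has_normal_basis_alg_isomorphic[OF assms(1)]
  obtain a q where "has_normal_basis a q" using has_normal_basis_exists[OF assms] by blast
  then consider "has_normal_basis 1 0" | "has_normal_basis 0 0" | "has_normal_basis \<i> 1"
    | "has_normal_basis 0 1"
    using has_normal_basis_cases by blast
  then show ?thesis
  proof cases
    case 1
    then have "alg_isomorphic scale bracket (*s) mu1"
      by (rule iso) (simp add: Finite_Cartesian_Product.vec_eq_iff mu_nth algebra_simps)
    then show ?thesis by simp
  next
    case 2
    then have "alg_isomorphic scale bracket (*s) mu2"
      by (rule iso) (simp add: Finite_Cartesian_Product.vec_eq_iff mu_nth algebra_simps)
    then show ?thesis by simp
  next
    case 3
    then have "alg_isomorphic scale bracket (*s) mu3"
      by (rule iso) (simp add: Finite_Cartesian_Product.vec_eq_iff mu_nth algebra_simps)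
    then show ?thesis by simp
  next
    case 4
    then have "alg_isomorphic scale bracket (*s) mu4"
      by (rule iso) (simp add: Finite_Cartesian_Product.vec_eq_iff mu_nth algebra_simps)
    then show ?thesis by simp
  qed
qed

end

theorem proposition2p4:
  fixes scale :: "complex \<Rightarrow> 'a::ab_group_add \<Rightarrow> 'a"
    and bracket :: "'a \<Rightarrow> 'a \<Rightarrow> 'a"
  shows "(leibniz_algebra scale bracket \<and>
          vector_space.dim scale (UNIV :: 'a set) = 5 \<and>
          leibniz_algebra.naturally_graded scale bracket \<and>
          leibniz_algebra.two_filiform scale bracket \<and>
          leibniz_algebra.type_mu_I scale bracket 1 2 \<longrightarrow>
            alg_isomorphic scale bracket (*s) mu1 \<or>
            alg_isomorphic scale bracket (*s) mu2 \<or>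
            alg_isomorphic scale bracket (*s) mu3 \<or>
            alg_isomorphic scale bracket (*s) mu4) \<and>
         \<not> alg_isomorphic (*s) mu1 (*s) mu2 \<and>
         \<not> alg_isomorphic (*s) mu1 (*s) mu3 \<and>
         \<not> alg_isomorphic (*s) mu1 (*s) mu4 \<and>
         \<not> alg_isomorphic (*s) mu2 (*s) mu3 \<and>
         \<not> alg_isomorphic (*s) mu2 (*s) mu4 \<and>
         \<not> alg_isomorphic (*s) mu3 (*s) mu4"
proof (intro conjI impI mu_pairwise_not_isomorphic)
  assume "leibniz_algebra scale bracket \<and> vector_space.dim scale (UNIV :: 'a set) = 5 \<and>
    leibniz_algebra.naturally_graded scale bracket \<and>
    leibniz_algebra.two_filiform scale bracket \<and> leibniz_algebra.type_mu_I scale bracket 1 2"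
  then show "alg_isomorphic scale bracket (*s) mu1 \<or> alg_isomorphic scale bracket (*s) mu2 \<or>
      alg_isomorphic scale bracket (*s) mu3 \<or> alg_isomorphic scale bracket (*s) mu4"
    using leibniz_algebra.mu_classification by blast
qed

end
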